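(* Let $C$ be the set of rational Cauchy sequences, with the closeness relation $\sim$, the elements $0_C,1_C$, the operations $+,\cdot$ and the relation $<$ defined in the context. Then the structure $(C,\,0_C,\,1_C,\,+,\,\cdot,\,<)$ is an ordered field congruent to the closeness relation $\sim$ (in the sense defined in the context).
   Context: Here $\mathbb{N}=\{1,2,3,\dots\}$, and $k,l,m,n,n_0,\dots$ range over $\mathbb{N}$. A sequence $(a_n)=(a_n)_{n\in\mathbb{N}}$ in $\mathbb{Q}$ is Cauchy if $\forall k\,\exists n_0\,(m,n\ge n_0\Rightarrow |a_m-a_n|\le 1/k)$. Let $C$ be the set of all Cauchy sequences in $\mathbb{Q}$ (two elements of $C$ are equal only if they are equal as sequences; no quotient is taken). The closeness relation $\sim$ on $C$ is the equivalence relation $(a_n)\sim(b_n)\iff \forall k\,\exists n_0\,(n\ge n_0\Rightarrow |a_n-b_n|\le 1/k)$. Put $0_C:=(0,0,\dots)$, $1_C:=(1,1,\dots)$, $(a_n)+(b_n):=(a_n+b_n)$, $(a_n)\cdot(b_n):=(a_nb_n)$, and $(a_n)<(b_n)\iff \exists k\,\exists n_0\,(n\ge n_0\Rightarrow a_n<b_n-1/k)$. Let $X$ be a nonempty set with an equivalence relation $\sim$. A binary operation $+$ on $X$ is congruent to $\sim$ if $a\sim a'$ and $b\sim b'$ imply $a+b\sim a'+b'$ for all $a,a',b,b'\in X$. A binary relation $A$ on $X$ is congruent to $\sim$ if $a\sim a'$ and $b\sim b'$ imply ($aAb\iff a'Ab'$) for all $a,a',b,b'\in X$. An ordered field (on $X$)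 congruent to $\sim$ is a six-tuple $(X,0_X,1_X,+,\cdot,<)$ such that: (1) $(X,0_X,1_X,+,\cdot)$ is a commutative ring with identity (ring axioms hold with genuine equality $=$); (2) the operations $+$ and $\cdot$ are congruent to $\sim$; (3) $<$ is an irreflexive and transitive relation on $X$ that is congruent to $\sim$; (4) for all $a,b,c\in X$: $a<b\Rightarrow a+c<b+c$, and ($a>0_X$ and $b>0_X$) $\Rightarrow a\cdot b>0_X$; (5) (weak multiplicative inverses) for every $a\in X$ with $a\not\sim 0_X$ there is $b\in X$ with $a\cdot b\sim 1_X$; (6) (weak trichotomy) for all $a,b\in X$: $a<b$ or $b<a$ or $a\sim b$. *)

theory Defs
  imports Complex_Main "HOL-Algebra.Ring"
begin

definition op_congruent :: "'a set \<Rightarrow> 'a rel \<Rightarrow> ('a \<Rightarrow> 'a \<Rightarrow> 'a) \<Rightarrow> bool" where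
  "op_congruent X R f \<longleftrightarrow>
     (\<forall>a\<in>X. \<forall>a'\<in>X. \<forall>b\<in>X. \<forall>b'\<in>X.
        (a, a') \<in> R \<longrightarrow> (b, b') \<in> R \<longrightarrow> (f a b, f a' b') \<in> R)"

definition rel_congruent :: "'a set \<Rightarrow> 'a rel \<Rightarrow> ('a \<Rightarrow> 'a \<Rightarrow> bool) \<Rightarrow> bool" where
  "rel_congruent X R A \<longleftrightarrow>
     (\<forall>a\<in>X. \<forall>a'\<in>X. \<forall>b\<in>X. \<forall>b'\<in>X.
        (a, a') \<in> R \<longrightarrow> (b, b') \<in> R \<longrightarrow> (A a b \<longleftrightarrow> A a' b'))"

record 'a ring_with_less = "'a ring" +
  lt :: "'a \<Rightarrow> 'a \<Rightarrow> bool"  (infixl \<open>\<prec>\<index>\<close> 50)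

locale ordered_field_congruent = cring F
  for F :: "('a, 'm) ring_with_less_scheme" (structure) +
  fixes R :: "'a rel"
  assumes nonempty: "carrier F \<noteq> {}"
    and equiv_R: "equiv (carrier F) R"
    and add_congruent: "op_congruent (carrier F) R (\<lambda>a b. a \<oplus> b)"
    and mult_congruent: "op_congruent (carrier F) R (\<lambda>a b. a \<otimes> b)"
    and lt_irrefl: "irreflp_on (carrier F) (\<lambda>a b. a \<prec> b)"
    and lt_trans: "transp_on (carrier F) (\<lambda>a b. a \<prec> b)"
    and lt_congruent: "rel_congruent (carrier F) R (\<lambda>a b. a \<prec> b)"
    and add_lt_mono:
      "\<lbrakk>a \<in> carrier F; b \<in> carrier F; c \<in> carrier F; a \<prec> b\<rbrakk> \<Longrightarrow> a \<oplus> c \<prec> b \<oplus> c"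
    and mult_pos:
      "\<lbrakk>a \<in> carrier F; b \<in> carrier F; \<zero> \<prec> a; \<zero> \<prec> b\<rbrakk> \<Longrightarrow> \<zero> \<prec> a \<otimes> b"
    and weak_inverse:
      "\<lbrakk>a \<in> carrier F; (a, \<zero>) \<notin> R\<rbrakk> \<Longrightarrow> \<exists>b\<in>carrier F. (a \<otimes> b, \<one>) \<in> R"
    and weak_trichotomy:
      "\<lbrakk>a \<in> carrier F; b \<in> carrier F\<rbrakk> \<Longrightarrow> a \<prec> b \<or> b \<prec> a \<or> (a, b) \<in> R"

text \<open>Index set and parameters range over the positive integers. A sequence is a function on
  \<open>{1..}\<close> that is \<open>undefined\<close> at \<open>0\<close>, so that HOL equality is equality of sequences.\<close>

definition cauchy_seqs :: "(nat \<Rightarrow> rat) set" where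
  "cauchy_seqs =
     {a \<in> {1..} \<rightarrow>\<^sub>E UNIV.
        \<forall>k\<ge>1. \<exists>n0\<ge>1. \<forall>m\<ge>n0. \<forall>n\<ge>n0. \<bar>a m - a n\<bar> \<le> 1 / rat_of_nat k}"

definition closeness :: "(nat \<Rightarrow> rat) rel" where
  "closeness =
     {(a, b). a \<in> cauchy_seqs \<and> b \<in> cauchy_seqs \<and>
        (\<forall>k\<ge>1. \<exists>n0\<ge>1. \<forall>n\<ge>n0. \<bar>a n - b n\<bar> \<le> 1 / rat_of_nat k)}"

definition seq_less :: "(nat \<Rightarrow> rat) \<Rightarrow> (nat \<Rightarrow> rat) \<Rightarrow> bool" where
  "seq_less a b \<longleftrightarrow> (\<exists>k\<ge>1. \<exists>n0\<ge>1. \<forall>n\<ge>n0. a n < b n - 1 / rat_of_nat k)"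

definition cauchy_structure :: "(nat \<Rightarrow> rat) ring_with_less" where
  "cauchy_structure =
     \<lparr>carrier = cauchy_seqs,
      mult = (\<lambda>a b. \<lambda>n\<in>{1..}. a n * b n),
      one = (\<lambda>n\<in>{1..}. 1),
      zero = (\<lambda>n\<in>{1..}. 0),
      add = (\<lambda>a b. \<lambda>n\<in>{1..}. a n + b n),
      lt = seq_less\<rparr>"

end

theory Submission
  imports Defs
begin

text \<open>A rational sequence is Cauchy iff it converges in the reals. Under
  \<open>real_value a = lim a\<close> closeness becomes equality of limits, \<open>seq_less\<close> becomes \<open><\<close> between
  limits, and the operations become those of the field of reals, so every axiom involving
  \<open>\<sim>\<close> or \<open><\<close> reduces to the corresponding property of the reals. Only the commutative ring
  axioms, which hold with genuine equality, are checked pointwise.\<close>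

abbreviation real_seq :: "(nat \<Rightarrow> rat) \<Rightarrow> nat \<Rightarrow> real" where
  "real_seq a \<equiv> \<lambda>n. real_of_rat (a n)"

text \<open>\<open>lim\<close> is a definite description and says nothing about divergent sequences,
  so the facts below assume membership in \<open>cauchy_seqs\<close> or a known limit.\<close>

definition real_value :: "(nat \<Rightarrow> rat) \<Rightarrow> real" where
  "real_value a = lim (real_seq a)"

section \<open>Transfer of the bounds from the rationals to the reals\<close>

lemma abs_diff_le_iff_real_of_rat:
  "\<bar>x - y\<bar> \<le> 1 / rat_of_nat k \<longleftrightarrow> \<bar>real_of_rat x - real_of_rat y\<bar> \<le> 1 / real k"
proof -
  have "\<bar>x - y\<bar> \<le> 1 / rat_of_nat k \<longleftrightarrow> real_of_rat \<bar>x - y\<bar> \<le> real_of_rat (1 / rat_of_nat k)"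
    by (simp only: of_rat_less_eq)
  also have "real_of_rat \<bar>x - y\<bar> = \<bar>real_of_rat x - real_of_rat y\<bar>"
    by (cases "x < y") (simp_all add: abs_if of_rat_diff of_rat_less)
  also have "real_of_rat (1 / rat_of_nat k) = 1 / real k"
    by (simp add: of_rat_divide)
  finally show ?thesis .
qed

lemma less_diff_iff_real_of_rat:
  "x < y - 1 / rat_of_nat k \<longleftrightarrow> real_of_rat x < real_of_rat y - 1 / real k"
proof -
  have "x < y - 1 / rat_of_nat k \<longleftrightarrow> real_of_rat x < real_of_rat (y - 1 / rat_of_nat k)"
    by (simp only: of_rat_less)
  then show ?thesis
    by (simp add: of_rat_diff of_rat_divide)
qed

text \<open>Lets the bounds \<open>1 / k\<close> of the definitions replace an arbitrary real
  epsilon.\<close>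

lemma ex_inverse_nat_less:
  fixes e :: real
  assumes "e > 0"
  obtains k where "k \<ge> 1" "1 / real k < e"
proof -
  from reals_Archimedean[OF assms] obtain n where "inverse (real (Suc n)) < e" ..
  then show thesis by (intro that[of "Suc n"]) (simp_all add: inverse_eq_divide)
qed

section \<open>Cauchy sequences, closeness and order through real limits\<close>

text \<open>By the Archimedean property the bounds \<open>1 / k\<close> express the usual Cauchy
  condition, which completeness of the reals turns into convergence. Of the function space only
  extensionality remains, since its codomain is \<open>UNIV\<close>.\<close>

lemma cauchy_seqs_iff:
  "a \<in> cauchy_seqs \<longleftrightarrow> a \<in> extensional {1..} \<and> convergent (real_seq a)"
proof -
  have "(\<forall>k\<ge>1. \<exists>n0\<ge>1. \<forall>m\<ge>n0. \<forall>n\<ge>n0. \<bar>a m - a n\<bar> \<le> 1 / rat_of_nat k)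
    \<longleftrightarrow> Cauchy (real_seq a)" (is "?L \<longleftrightarrow> _")
  proof
    assume L: ?L
    show "Cauchy (real_seq a)"
    proof (rule metric_CauchyI)
      fix e :: real assume "e > 0"
      then obtain k where k: "k \<ge> 1" "1 / real k < e" by (rule ex_inverse_nat_less)
      with L obtain n0 where "\<forall>m\<ge>n0. \<forall>n\<ge>n0. \<bar>real_seq a m - real_seq a n\<bar> \<le> 1 / real k"
        unfolding abs_diff_le_iff_real_of_rat by blast
      with k show "\<exists>M. \<forall>m\<ge>M. \<forall>n\<ge>M. dist (real_seq a m) (real_seq a n) < e"
        unfolding dist_real_def by (meson le_less_trans)
    qed
  next
    assume C: "Cauchy (real_seq a)"
    show ?L
    proof (intro allI impI)
      fix k :: nat assume "k \<ge> 1"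
      then have "1 / real k > 0" by simp
      from metric_CauchyD[OF C this] obtain M
        where "\<forall>m\<ge>M. \<forall>n\<ge>M. \<bar>real_seq a m - real_seq a n\<bar> < 1 / real k"
        unfolding dist_real_def by blast
      \<comment> \<open>The index \<open>M\<close> may be 0, whereas the definition asks for a
        threshold of at least 1.\<close>
      then have "\<forall>m\<ge>max 1 M. \<forall>n\<ge>max 1 M. \<bar>a m - a n\<bar> \<le> 1 / rat_of_nat k"
        unfolding abs_diff_le_iff_real_of_rat by (simp add: less_imp_le)
      then show "\<exists>n0\<ge>1. \<forall>m\<ge>n0. \<forall>n\<ge>n0. \<bar>a m - a n\<bar> \<le> 1 / rat_of_nat k"
        using max.cobounded1 by blast
    qed
  qed
  then show ?thesis
    by (simp add: cauchy_seqs_def PiE_def Cauchy_convergent_iff)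
qed

lemma tendsto_real_value:
  "a \<in> cauchy_seqs \<Longrightarrow> real_seq a \<longlonglongrightarrow> real_value a"
  by (simp add: cauchy_seqs_iff real_value_def convergent_LIMSEQ_iff)

lemma cauchy_seqsI:
  assumes "a \<in> extensional {1..}" "real_seq a \<longlonglongrightarrow> x"
  shows "a \<in> cauchy_seqs" "real_value a = x"
  using assms by (auto simp: cauchy_seqs_iff real_value_def convergent_def limI)

text \<open>The differences converge to the difference of the values. Nonstrict bounds pass to the
  limit, so closeness forces that limit below every positive number in absolute value; conversely a
  limit 0 gives all the bounds. Outside \<open>cauchy_seqs\<close> both sides are false.\<close>

lemma closeness_iff:
  "(a, b) \<in> closeness \<longleftrightarrow> a \<in> cauchy_seqs \<and> b \<in> cauchy_seqs \<and> real_value a = real_value b"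
proof (cases "a \<in> cauchy_seqs \<and> b \<in> cauchy_seqs")
  case True
  then have lim: "(\<lambda>n. real_seq a n - real_seq b n) \<longlonglongrightarrow> real_value a - real_value b"
    by (intro tendsto_diff tendsto_real_value) auto
  have "(\<forall>k\<ge>1. \<exists>n0\<ge>1. \<forall>n\<ge>n0. \<bar>a n - b n\<bar> \<le> 1 / rat_of_nat k)
    \<longleftrightarrow> real_value a = real_value b" (is "?L \<longleftrightarrow> _")
  proof
    assume L: ?L
    have "\<bar>real_value a - real_value b\<bar> \<le> e" if "e > 0" for e
    proof -
      from that obtain k where k: "k \<ge> 1" "1 / real k < e" by (rule ex_inverse_nat_less)
      with L obtain n0 where n0: "\<forall>n\<ge>n0. \<bar>real_seq a n - real_seq b n\<bar> \<le> 1 / real k"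
        unfolding abs_diff_le_iff_real_of_rat by blast
      have "\<bar>real_value a - real_value b\<bar> \<le> 1 / real k"
        by (rule LIMSEQ_le_const2[OF tendsto_rabs[OF lim]]) (use n0 in blast)
      with k show ?thesis by simp
    qed
    then have "\<bar>real_value a - real_value b\<bar> \<le> 0"
      by (rule field_le_epsilon) simp
    then show "real_value a = real_value b" by simp
  next
    assume "real_value a = real_value b"
    with lim have lim0: "(\<lambda>n. real_seq a n - real_seq b n) \<longlonglongrightarrow> 0" by simp
    show ?L
    proof (intro allI impI)
      fix k :: nat assume "k \<ge> 1"
      then have "1 / real k > 0" by simp
      from LIMSEQ_D[OF lim0 this] obtain M
        where "\<forall>n\<ge>M. \<bar>real_seq a n - real_seq b n\<bar> < 1 / real k" by auto
      then have "\<forall>n\<ge>max 1 M. \<bar>a n - b n\<bar> \<le> 1 / rat_of_nat k"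
        unfolding abs_diff_le_iff_real_of_rat by (simp add: less_imp_le)
      then show "\<exists>n0\<ge>1. \<forall>n\<ge>n0. \<bar>a n - b n\<bar> \<le> 1 / rat_of_nat k"
        using max.cobounded1 by blast
    qed
  qed
  with True show ?thesis by (simp add: closeness_def)
qed (auto simp: closeness_def)

text \<open>The uniform gap \<open>1 / k\<close> keeps the inequality strict in the limit, where
  entrywise \<open><\<close> alone would only give \<le>. Conversely, any \<open>1 / k\<close>
  strictly below the gap between the limits is eventually a gap between the entries.\<close>

lemma seq_less_iff:
  assumes "a \<in> cauchy_seqs" "b \<in> cauchy_seqs"
  shows "seq_less a b \<longleftrightarrow> real_value a < real_value b"
proof
  have lim: "(\<lambda>n. real_seq b n - real_seq a n) \<longlonglongrightarrow> real_value b - real_value a"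
    using assms by (intro tendsto_diff tendsto_real_value)
  {
    assume "seq_less a b"
    then obtain k n0 where k: "k \<ge> 1" and
      n0: "\<forall>n\<ge>n0. real_seq a n < real_seq b n - 1 / real k"
      unfolding seq_less_def less_diff_iff_real_of_rat by blast
    have "1 / real k \<le> real_value b - real_value a"
      by (rule LIMSEQ_le_const[OF lim]) (use n0 in \<open>force intro!: exI[of _ n0]\<close>)
    moreover have "1 / real k > 0" using k by simp
    ultimately show "real_value a < real_value b" by linarith
  }
  {
    assume "real_value a < real_value b"
    then obtain k where k: "k \<ge> 1" "1 / real k < real_value b - real_value a"
      using ex_inverse_nat_less[of "real_value b - real_value a"] by auto
    from order_tendstoD(1)[OF lim k(2)] obtain M
      where M: "\<forall>n\<ge>M. 1 / real k < real_seq b n - real_seq a n"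
      by (auto simp: eventually_sequentially)
    have "\<forall>n\<ge>max 1 M. a n < b n - 1 / rat_of_nat k"
      unfolding less_diff_iff_real_of_rat using M by (simp add: algebra_simps)
    with k(1) show "seq_less a b"
      unfolding seq_less_def using max.cobounded1 by blast
  }
qed

section \<open>Limits of constants, sums, products and inverses\<close>

text \<open>Restriction changes at most the entry at index 0, which no limit sees.\<close>

lemma real_seq_restrict_tendsto_iff:
  "real_seq (\<lambda>n\<in>{1..}. f n) \<longlonglongrightarrow> x \<longleftrightarrow> real_seq f \<longlonglongrightarrow> x"
  by (rule tendsto_cong) (auto simp: eventually_sequentially intro!: exI[of _ 1])

lemma cauchy_seqs_const:
  "(\<lambda>n\<in>{1..}. c) \<in> cauchy_seqs" "real_value (\<lambda>n\<in>{1..}. c) = real_of_rat c"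
proof -
  have "real_seq (\<lambda>n\<in>{1..}. c) \<longlonglongrightarrow> real_of_rat c"
    unfolding real_seq_restrict_tendsto_iff by simp
  then show "(\<lambda>n\<in>{1..}. c) \<in> cauchy_seqs" "real_value (\<lambda>n\<in>{1..}. c) = real_of_rat c"
    by (auto intro: cauchy_seqsI simp del: restrict_apply)
qed

lemma cauchy_seqs_add:
  assumes "a \<in> cauchy_seqs" "b \<in> cauchy_seqs"
  shows "(\<lambda>n\<in>{1..}. a n + b n) \<in> cauchy_seqs"
    and "real_value (\<lambda>n\<in>{1..}. a n + b n) = real_value a + real_value b"
proof -
  have "real_seq (\<lambda>n\<in>{1..}. a n + b n) \<longlonglongrightarrow> real_value a + real_value b"
    unfolding real_seq_restrict_tendsto_iff of_rat_add
    using assms by (intro tendsto_add tendsto_real_value)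
  then show "(\<lambda>n\<in>{1..}. a n + b n) \<in> cauchy_seqs"
    and "real_value (\<lambda>n\<in>{1..}. a n + b n) = real_value a + real_value b"
    by (auto intro: cauchy_seqsI simp del: restrict_apply)
qed

lemma cauchy_seqs_mult:
  assumes "a \<in> cauchy_seqs" "b \<in> cauchy_seqs"
  shows "(\<lambda>n\<in>{1..}. a n * b n) \<in> cauchy_seqs"
    and "real_value (\<lambda>n\<in>{1..}. a n * b n) = real_value a * real_value b"
proof -
  have "real_seq (\<lambda>n\<in>{1..}. a n * b n) \<longlonglongrightarrow> real_value a * real_value b"
    unfolding real_seq_restrict_tendsto_iff of_rat_mult
    using assms by (intro tendsto_mult tendsto_real_value)
  then show "(\<lambda>n\<in>{1..}. a n * b n) \<in> cauchy_seqs"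
    and "real_value (\<lambda>n\<in>{1..}. a n * b n) = real_value a * real_value b"
    by (auto intro: cauchy_seqsI simp del: restrict_apply)
qed

text \<open>Entries \<open>a n = 0\<close> are harmless: there are only finitely many, and \<open>inverse 0 = 0\<close>.\<close>

lemma cauchy_seqs_inverse:
  assumes "a \<in> cauchy_seqs" "real_value a \<noteq> 0"
  shows "(\<lambda>n\<in>{1..}. inverse (a n)) \<in> cauchy_seqs"
    and "real_value (\<lambda>n\<in>{1..}. inverse (a n)) = inverse (real_value a)"
proof -
  have "real_seq (\<lambda>n\<in>{1..}. inverse (a n)) \<longlonglongrightarrow> inverse (real_value a)"
    unfolding real_seq_restrict_tendsto_iff of_rat_inverse
    using assms by (intro tendsto_inverse tendsto_real_value)
  then show "(\<lambda>n\<in>{1..}. inverse (a n)) \<in> cauchy_seqs"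
    and "real_value (\<lambda>n\<in>{1..}. inverse (a n)) = inverse (real_value a)"
    by (auto intro: cauchy_seqsI simp del: restrict_apply)
qed

section \<open>The ring structure\<close>

text \<open>Both sequences are \<open>undefined\<close> at 0, so agreement at the positive indices
  is genuine equality. This reduces the ring equations to identities between rational
  entries.\<close>

lemma cauchy_seqs_cong:
  assumes "a \<in> cauchy_seqs" "b \<in> cauchy_seqs" "\<And>n. n \<ge> 1 \<Longrightarrow> a n = b n"
  shows "a = b"
  using assms by (intro extensionalityI[of a "{1..}" b]) (auto simp: cauchy_seqs_iff)

lemma cauchy_structure_carrier_lt:
  "carrier cauchy_structure = cauchy_seqs"
  "lt cauchy_structure = seq_less"
  by (simp_all add: cauchy_structure_def)

lemma cauchy_structure_apply:
  assumes "n \<ge> 1"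
  shows "\<zero>\<^bsub>cauchy_structure\<^esub> n = 0"
    and "\<one>\<^bsub>cauchy_structure\<^esub> n = 1"
    and "(a \<oplus>\<^bsub>cauchy_structure\<^esub> b) n = a n + b n"
    and "(a \<otimes>\<^bsub>cauchy_structure\<^esub> b) n = a n * b n"
  using assms by (simp_all add: cauchy_structure_def)

lemma cauchy_structure_closed:
  "\<zero>\<^bsub>cauchy_structure\<^esub> \<in> cauchy_seqs"
  "\<one>\<^bsub>cauchy_structure\<^esub> \<in> cauchy_seqs"
  "a \<in> cauchy_seqs \<Longrightarrow> b \<in> cauchy_seqs \<Longrightarrow> a \<oplus>\<^bsub>cauchy_structure\<^esub> b \<in> cauchy_seqs"
  "a \<in> cauchy_seqs \<Longrightarrow> b \<in> cauchy_seqs \<Longrightarrow> a \<otimes>\<^bsub>cauchy_structure\<^esub> b \<in> cauchy_seqs"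
  unfolding cauchy_structure_def ring_record_simps monoid.simps
  by (fact cauchy_seqs_const cauchy_seqs_add cauchy_seqs_mult)+

text \<open>These equations make \<open>real_value\<close> a ring homomorphism from the Cauchy
  sequences to the reals; closeness is equality of its values.\<close>

lemma real_value_cauchy_structure:
  "real_value \<zero>\<^bsub>cauchy_structure\<^esub> = 0"
  "real_value \<one>\<^bsub>cauchy_structure\<^esub> = 1"
  "a \<in> cauchy_seqs \<Longrightarrow> b \<in> cauchy_seqs \<Longrightarrow>
    real_value (a \<oplus>\<^bsub>cauchy_structure\<^esub> b) = real_value a + real_value b"
  "a \<in> cauchy_seqs \<Longrightarrow> b \<in> cauchy_seqs \<Longrightarrow>
    real_value (a \<otimes>\<^bsub>cauchy_structure\<^esub> b) = real_value a * real_value b"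
  unfolding cauchy_structure_def ring_record_simps monoid.simps
  by (simp_all add: cauchy_seqs_const cauchy_seqs_add cauchy_seqs_mult
      del: One_nat_def restrict_apply)

lemma cring_cauchy_structure: "cring cauchy_structure"
proof (rule cringI)
  note simps = cauchy_structure_carrier_lt cauchy_structure_apply cauchy_structure_closed
    algebra_simps
  show "abelian_group cauchy_structure"
  proof (rule abelian_groupI)
    fix a assume a: "a \<in> carrier cauchy_structure"
    \<comment> \<open>The negative of \<open>a\<close> is written as a product with the constant
      sequence -1, so that it is Cauchy by closure under products.\<close>
    let ?b = "(\<lambda>n\<in>{1..}. - 1) \<otimes>\<^bsub>cauchy_structure\<^esub> a"
    have "?b \<in> cauchy_seqs"
      using a by (intro cauchy_structure_closed cauchy_seqs_const)
        (simp add: cauchy_structure_carrier_lt)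
    moreover from this have "?b \<oplus>\<^bsub>cauchy_structure\<^esub> a = \<zero>\<^bsub>cauchy_structure\<^esub>"
      using a by (intro cauchy_seqs_cong) (simp_all add: simps del: One_nat_def)
    ultimately show "\<exists>b\<in>carrier cauchy_structure.
        b \<oplus>\<^bsub>cauchy_structure\<^esub> a = \<zero>\<^bsub>cauchy_structure\<^esub>"
      by (auto simp: cauchy_structure_carrier_lt)
  qed (auto simp: simps simp del: One_nat_def intro!: cauchy_seqs_cong)
  show "comm_monoid cauchy_structure"
    by (rule comm_monoidI) (auto simp: simps simp del: One_nat_def intro!: cauchy_seqs_cong)
  show "(a \<oplus>\<^bsub>cauchy_structure\<^esub> b) \<otimes>\<^bsub>cauchy_structure\<^esub> c =
      a \<otimes>\<^bsub>cauchy_structure\<^esub> c \<oplus>\<^bsub>cauchy_structure\<^esub> b \<otimes>\<^bsub>cauchy_structure\<^esub> c"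
    if "a \<in> carrier cauchy_structure" "b \<in> carrier cauchy_structure" "c \<in> carrier cauchy_structure"
    for a b c
    using that by (intro cauchy_seqs_cong) (auto simp: simps simp del: One_nat_def)
qed

section \<open>The axioms on closeness and order\<close>

theorem theorem3p4:
  shows "ordered_field_congruent cauchy_structure closeness"
proof -
  interpret cring cauchy_structure by (rule cring_cauchy_structure)
  note simps = cauchy_structure_carrier_lt closeness_iff seq_less_iff
    cauchy_structure_closed real_value_cauchy_structure
  show ?thesis
  proof unfold_locales
    show "carrier cauchy_structure \<noteq> {}"
      using one_closed by blast
    show "equiv (carrier cauchy_structure) closeness"
      by (auto simp: simps intro!: equivI refl_onI symI transI)
    show "op_congruent (carrier cauchy_structure) closeness (\<lambda>a b. a \<oplus>\<^bsub>cauchy_structure\<^esub> b)"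
      by (simp add: simps op_congruent_def)
    show "op_congruent (carrier cauchy_structure) closeness (\<lambda>a b. a \<otimes>\<^bsub>cauchy_structure\<^esub> b)"
      by (simp add: simps op_congruent_def)
    show "irreflp_on (carrier cauchy_structure) (\<lambda>a b. a \<prec>\<^bsub>cauchy_structure\<^esub> b)"
      by (simp add: simps irreflp_on_def)
    show "transp_on (carrier cauchy_structure) (\<lambda>a b. a \<prec>\<^bsub>cauchy_structure\<^esub> b)"
      by (auto simp: simps transp_on_def)
    show "rel_congruent (carrier cauchy_structure) closeness (\<lambda>a b. a \<prec>\<^bsub>cauchy_structure\<^esub> b)"
      by (simp add: simps rel_congruent_def)
  next
    \<comment> \<open>The zero sequence has value 0, so not being close to it means having a nonzero
      value.\<close>
    fix a assume "a \<in> carrier cauchy_structure" "(a, \<zero>\<^bsub>cauchy_structure\<^esub>) \<notin> closeness"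
    then have a: "a \<in> cauchy_seqs" "real_value a \<noteq> 0"
      by (simp_all add: simps)
    show "\<exists>b\<in>carrier cauchy_structure.
        (a \<otimes>\<^bsub>cauchy_structure\<^esub> b, \<one>\<^bsub>cauchy_structure\<^esub>) \<in> closeness"
      \<comment> \<open>The witness is the entrywise inverse: the product has value 1. Where
        \<open>a n = 0\<close> its entry is 0, so in general it is only close to the unit sequence,
        not equal to it.\<close>
      using a cauchy_seqs_inverse[OF a]
      by (intro bexI[of _ "\<lambda>n\<in>{1..}. inverse (a n)"])
        (simp_all add: simps del: restrict_apply One_nat_def)
  \<comment> \<open>What remains is monotonicity of addition, positivity of products and weak
    trichotomy; the last is linearity of the order on the reals, with equal values meaning
    closeness.\<close>
  qed (auto simp: simps)
qed

end
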